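(* Let $C$ be a strict $C^*$-tensor category and let $(X,m,\iota)$ be a Q-system in $C$. Then $T:=m^*m\in\mathrm{Hom}_C(X\otimes X,X\otimes X)$ fulfills the categorical (quantum) Yang--Baxter equation $$(T\otimes1_X)(1_X\otimes T)(T\otimes1_X)=(1_X\otimes T)(T\otimes1_X)(1_X\otimes T).$$
   Context: $C$ has simple tensor unit $\mathrm{id}$, tensor multiplication $\otimes$, and the adjoint of a morphism $t$ is $t^*$; $1_X$ is the identity morphism of $X$. A Q-system in $C$ is a triple $(X,m,\iota)$ with $X$ an object and morphisms $m:X\otimes X\to X$, $\iota:\mathrm{id}\to X$ satisfying associativity $m(m\otimes1_X)=m(1_X\otimes m)$; unitality $m(\iota\otimes1_X)=1_X=m(1_X\otimes\iota)$; the $C^*$-Frobenius property $(m\otimes1_X)(1_X\otimes m^* )=m^*m=(1_X\otimes m)(m^*\otimes1_X)$; specialness $mm^*=d\,1_X$ for some $d>0$; normalization $\iota^*\iota=1_{\mathrm{id}}$. *)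

theory Defs
  imports "HOL-Analysis.Analysis" "HOL-Algebra.Module"
begin

definition complex_ring :: "complex ring" where
  "complex_ring = \<lparr>carrier = UNIV, mult = (*), one = 1, zero = 0, add = (+)\<rparr>"

text \<open>
  The space of morphisms from \<open>X\<close> to \<open>Y\<close> is \<open>Hom C X Y\<close>; its set of elements is
  \<open>carrier (Hom C X Y)\<close>. Of the library record for modules only the carrier, zero, addition
  and scalar multiplication are relevant; the fields \<open>mult\<close> and \<open>one\<close> stay unconstrained,
  composition being a separate operation. Composition is written in the applicative order:
  \<open>g \<cdot> f\<close> means first \<open>f\<close>, then \<open>g\<close>.
\<close>

record ('o, 'm) cstar_category =
  Ob :: "'o set"
  Hom :: "'o \<Rightarrow> 'o \<Rightarrow> (complex, 'm) module"
  Ident :: "'o \<Rightarrow> 'm"  (\<open>\<one>\<^sub>m\<index>\<close>)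
  Comp :: "'m \<Rightarrow> 'm \<Rightarrow> 'm"  (infixl \<open>\<cdot>\<index>\<close> 72)
  Adj :: "'m \<Rightarrow> 'm"  (\<open>_\<^sup>\<dagger>\<index>\<close> [1000] 1000)
  Nrm :: "'m \<Rightarrow> real"

locale cstar_category =
  fixes C :: "('o, 'm, 'e) cstar_category_scheme" (structure)
  assumes Hom_disjoint:
      "\<lbrakk>X \<in> Ob C; Y \<in> Ob C; X' \<in> Ob C; Y' \<in> Ob C;
        f \<in> carrier (Hom C X Y); f \<in> carrier (Hom C X' Y')\<rbrakk> \<Longrightarrow> X = X' \<and> Y = Y'"
    and Ident_closed: "X \<in> Ob C \<Longrightarrow> \<one>\<^sub>m X \<in> carrier (Hom C X X)"
    and Comp_closed:
      "\<lbrakk>X \<in> Ob C; Y \<in> Ob C; Z \<in> Ob C; f \<in> carrier (Hom C X Y); g \<in> carrier (Hom C Y Z)\<rbrakk>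
        \<Longrightarrow> g \<cdot> f \<in> carrier (Hom C X Z)"
    and Comp_Ident_right:
      "\<lbrakk>X \<in> Ob C; Y \<in> Ob C; f \<in> carrier (Hom C X Y)\<rbrakk> \<Longrightarrow> f \<cdot> \<one>\<^sub>m X = f"
    and Comp_Ident_left:
      "\<lbrakk>X \<in> Ob C; Y \<in> Ob C; f \<in> carrier (Hom C X Y)\<rbrakk> \<Longrightarrow> \<one>\<^sub>m Y \<cdot> f = f"
    and Comp_assoc:
      "\<lbrakk>W \<in> Ob C; X \<in> Ob C; Y \<in> Ob C; Z \<in> Ob C; f \<in> carrier (Hom C W X);
        g \<in> carrier (Hom C X Y); h \<in> carrier (Hom C Y Z)\<rbrakk> \<Longrightarrow> (h \<cdot> g) \<cdot> f = h \<cdot> (g \<cdot> f)"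

    and Hom_module: "\<lbrakk>X \<in> Ob C; Y \<in> Ob C\<rbrakk> \<Longrightarrow> module complex_ring (Hom C X Y)"
    and Comp_add_right:
      "\<lbrakk>X \<in> Ob C; Y \<in> Ob C; Z \<in> Ob C; f \<in> carrier (Hom C X Y); f' \<in> carrier (Hom C X Y);
        g \<in> carrier (Hom C Y Z)\<rbrakk>
        \<Longrightarrow> g \<cdot> (f \<oplus>\<^bsub>Hom C X Y\<^esub> f') = (g \<cdot> f) \<oplus>\<^bsub>Hom C X Z\<^esub> (g \<cdot> f')"
    and Comp_add_left:
      "\<lbrakk>X \<in> Ob C; Y \<in> Ob C; Z \<in> Ob C; f \<in> carrier (Hom C X Y); g \<in> carrier (Hom C Y Z);
        g' \<in> carrier (Hom C Y Z)\<rbrakk>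
        \<Longrightarrow> (g \<oplus>\<^bsub>Hom C Y Z\<^esub> g') \<cdot> f = (g \<cdot> f) \<oplus>\<^bsub>Hom C X Z\<^esub> (g' \<cdot> f)"
    and Comp_smult_right:
      "\<lbrakk>X \<in> Ob C; Y \<in> Ob C; Z \<in> Ob C; f \<in> carrier (Hom C X Y); g \<in> carrier (Hom C Y Z)\<rbrakk>
        \<Longrightarrow> g \<cdot> (c \<odot>\<^bsub>Hom C X Y\<^esub> f) = c \<odot>\<^bsub>Hom C X Z\<^esub> (g \<cdot> f)"
    and Comp_smult_left:
      "\<lbrakk>X \<in> Ob C; Y \<in> Ob C; Z \<in> Ob C; f \<in> carrier (Hom C X Y); g \<in> carrier (Hom C Y Z)\<rbrakk>
        \<Longrightarrow> (c \<odot>\<^bsub>Hom C Y Z\<^esub> g) \<cdot> f = c \<odot>\<^bsub>Hom C X Z\<^esub> (g \<cdot> f)"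

    and Adj_closed:
      "\<lbrakk>X \<in> Ob C; Y \<in> Ob C; f \<in> carrier (Hom C X Y)\<rbrakk> \<Longrightarrow> f\<^sup>\<dagger> \<in> carrier (Hom C Y X)"
    and Adj_Adj:
      "\<lbrakk>X \<in> Ob C; Y \<in> Ob C; f \<in> carrier (Hom C X Y)\<rbrakk> \<Longrightarrow> (f\<^sup>\<dagger>)\<^sup>\<dagger> = f"
    and Adj_Comp:
      "\<lbrakk>X \<in> Ob C; Y \<in> Ob C; Z \<in> Ob C; f \<in> carrier (Hom C X Y); g \<in> carrier (Hom C Y Z)\<rbrakk>
        \<Longrightarrow> (g \<cdot> f)\<^sup>\<dagger> = f\<^sup>\<dagger> \<cdot> g\<^sup>\<dagger>"
    and Adj_add:
      "\<lbrakk>X \<in> Ob C; Y \<in> Ob C; f \<in> carrier (Hom C X Y); g \<in> carrier (Hom C X Y)\<rbrakk>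
        \<Longrightarrow> (f \<oplus>\<^bsub>Hom C X Y\<^esub> g)\<^sup>\<dagger> = f\<^sup>\<dagger> \<oplus>\<^bsub>Hom C Y X\<^esub> g\<^sup>\<dagger>"
    and Adj_smult:
      "\<lbrakk>X \<in> Ob C; Y \<in> Ob C; f \<in> carrier (Hom C X Y)\<rbrakk>
        \<Longrightarrow> (c \<odot>\<^bsub>Hom C X Y\<^esub> f)\<^sup>\<dagger> = cnj c \<odot>\<^bsub>Hom C Y X\<^esub> f\<^sup>\<dagger>"

    and Nrm_nonneg:
      "\<lbrakk>X \<in> Ob C; Y \<in> Ob C; f \<in> carrier (Hom C X Y)\<rbrakk> \<Longrightarrow> 0 \<le> Nrm C f"
    and Nrm_eq_0_iff:
      "\<lbrakk>X \<in> Ob C; Y \<in> Ob C; f \<in> carrier (Hom C X Y)\<rbrakk>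
        \<Longrightarrow> Nrm C f = 0 \<longleftrightarrow> f = \<zero>\<^bsub>Hom C X Y\<^esub>"
    and Nrm_triangle:
      "\<lbrakk>X \<in> Ob C; Y \<in> Ob C; f \<in> carrier (Hom C X Y); g \<in> carrier (Hom C X Y)\<rbrakk>
        \<Longrightarrow> Nrm C (f \<oplus>\<^bsub>Hom C X Y\<^esub> g) \<le> Nrm C f + Nrm C g"
    and Nrm_smult:
      "\<lbrakk>X \<in> Ob C; Y \<in> Ob C; f \<in> carrier (Hom C X Y)\<rbrakk>
        \<Longrightarrow> Nrm C (c \<odot>\<^bsub>Hom C X Y\<^esub> f) = cmod c * Nrm C f"
    and Hom_complete:
      "\<lbrakk>X \<in> Ob C; Y \<in> Ob C; \<forall>n::nat. s n \<in> carrier (Hom C X Y);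
        \<forall>e>0. \<exists>N. \<forall>n\<ge>N. \<forall>k\<ge>N. Nrm C (s n \<ominus>\<^bsub>Hom C X Y\<^esub> s k) < e\<rbrakk>
        \<Longrightarrow> \<exists>f\<in>carrier (Hom C X Y). (\<lambda>n. Nrm C (s n \<ominus>\<^bsub>Hom C X Y\<^esub> f)) \<longlonglongrightarrow> 0"
    and Nrm_Comp:
      "\<lbrakk>X \<in> Ob C; Y \<in> Ob C; Z \<in> Ob C; f \<in> carrier (Hom C X Y); g \<in> carrier (Hom C Y Z)\<rbrakk>
        \<Longrightarrow> Nrm C (g \<cdot> f) \<le> Nrm C g * Nrm C f"
    and cstar_identity:
      "\<lbrakk>X \<in> Ob C; Y \<in> Ob C; f \<in> carrier (Hom C X Y)\<rbrakk> \<Longrightarrow> Nrm C (f\<^sup>\<dagger> \<cdot> f) = (Nrm C f)\<^sup>2"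
    \<comment> \<open>\<open>f\<^sup>\<dagger> \<cdot> f\<close> is a positive element of the C*-algebra \<open>End(X)\<close>; this does not follow from the
        other axioms when \<open>X \<noteq> Y\<close>.\<close>
    and Adj_Comp_positive:
      "\<lbrakk>X \<in> Ob C; Y \<in> Ob C; f \<in> carrier (Hom C X Y)\<rbrakk>
        \<Longrightarrow> \<exists>h\<in>carrier (Hom C X X). f\<^sup>\<dagger> \<cdot> f = h\<^sup>\<dagger> \<cdot> h"

record ('o, 'm) cstar_tensor_category = "('o, 'm) cstar_category" +
  Tensor_Ob :: "'o \<Rightarrow> 'o \<Rightarrow> 'o"  (infixl \<open>\<otimes>\<^sub>o\<index>\<close> 75)
  Tensor :: "'m \<Rightarrow> 'm \<Rightarrow> 'm"  (infixl \<open>\<otimes>\<^sub>m\<index>\<close> 75)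
  Unit_Ob :: "'o"  (\<open>\<one>\<^sub>o\<index>\<close>)

locale strict_cstar_tensor_category = cstar_category C
  for C :: "('o, 'm, 'e) cstar_tensor_category_scheme" (structure) +
  assumes Unit_Ob_closed: "\<one>\<^sub>o \<in> Ob C"
    and Tensor_Ob_closed: "\<lbrakk>X \<in> Ob C; Y \<in> Ob C\<rbrakk> \<Longrightarrow> X \<otimes>\<^sub>o Y \<in> Ob C"
    and Tensor_Ob_assoc:
      "\<lbrakk>X \<in> Ob C; Y \<in> Ob C; Z \<in> Ob C\<rbrakk> \<Longrightarrow> (X \<otimes>\<^sub>o Y) \<otimes>\<^sub>o Z = X \<otimes>\<^sub>o (Y \<otimes>\<^sub>o Z)"
    and Tensor_Ob_Unit_left: "X \<in> Ob C \<Longrightarrow> \<one>\<^sub>o \<otimes>\<^sub>o X = X"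
    and Tensor_Ob_Unit_right: "X \<in> Ob C \<Longrightarrow> X \<otimes>\<^sub>o \<one>\<^sub>o = X"

    and Tensor_closed:
      "\<lbrakk>X \<in> Ob C; Y \<in> Ob C; X' \<in> Ob C; Y' \<in> Ob C; f \<in> carrier (Hom C X Y);
        g \<in> carrier (Hom C X' Y')\<rbrakk> \<Longrightarrow> f \<otimes>\<^sub>m g \<in> carrier (Hom C (X \<otimes>\<^sub>o X') (Y \<otimes>\<^sub>o Y'))"
    and Tensor_Ident: "\<lbrakk>X \<in> Ob C; Y \<in> Ob C\<rbrakk> \<Longrightarrow> \<one>\<^sub>m X \<otimes>\<^sub>m \<one>\<^sub>m Y = \<one>\<^sub>m (X \<otimes>\<^sub>o Y)"
    and Tensor_Comp:
      "\<lbrakk>X \<in> Ob C; Y \<in> Ob C; Z \<in> Ob C; X' \<in> Ob C; Y' \<in> Ob C; Z' \<in> Ob C;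
        f \<in> carrier (Hom C X Y); g \<in> carrier (Hom C Y Z);
        f' \<in> carrier (Hom C X' Y'); g' \<in> carrier (Hom C Y' Z')\<rbrakk>
        \<Longrightarrow> (g \<cdot> f) \<otimes>\<^sub>m (g' \<cdot> f') = (g \<otimes>\<^sub>m g') \<cdot> (f \<otimes>\<^sub>m f')"
    and Tensor_assoc:
      "\<lbrakk>X \<in> Ob C; Y \<in> Ob C; X' \<in> Ob C; Y' \<in> Ob C; X'' \<in> Ob C; Y'' \<in> Ob C;
        f \<in> carrier (Hom C X Y); g \<in> carrier (Hom C X' Y'); h \<in> carrier (Hom C X'' Y'')\<rbrakk>
        \<Longrightarrow> (f \<otimes>\<^sub>m g) \<otimes>\<^sub>m h = f \<otimes>\<^sub>m (g \<otimes>\<^sub>m h)"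
    and Tensor_Unit_left:
      "\<lbrakk>X \<in> Ob C; Y \<in> Ob C; f \<in> carrier (Hom C X Y)\<rbrakk> \<Longrightarrow> \<one>\<^sub>m \<one>\<^sub>o \<otimes>\<^sub>m f = f"
    and Tensor_Unit_right:
      "\<lbrakk>X \<in> Ob C; Y \<in> Ob C; f \<in> carrier (Hom C X Y)\<rbrakk> \<Longrightarrow> f \<otimes>\<^sub>m \<one>\<^sub>m \<one>\<^sub>o = f"

    and Tensor_add_left:
      "\<lbrakk>X \<in> Ob C; Y \<in> Ob C; X' \<in> Ob C; Y' \<in> Ob C; f \<in> carrier (Hom C X Y);
        f' \<in> carrier (Hom C X Y); g \<in> carrier (Hom C X' Y')\<rbrakk>
        \<Longrightarrow> (f \<oplus>\<^bsub>Hom C X Y\<^esub> f') \<otimes>\<^sub>m g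
          = (f \<otimes>\<^sub>m g) \<oplus>\<^bsub>Hom C (X \<otimes>\<^sub>o X') (Y \<otimes>\<^sub>o Y')\<^esub> (f' \<otimes>\<^sub>m g)"
    and Tensor_add_right:
      "\<lbrakk>X \<in> Ob C; Y \<in> Ob C; X' \<in> Ob C; Y' \<in> Ob C; f \<in> carrier (Hom C X Y);
        g \<in> carrier (Hom C X' Y'); g' \<in> carrier (Hom C X' Y')\<rbrakk>
        \<Longrightarrow> f \<otimes>\<^sub>m (g \<oplus>\<^bsub>Hom C X' Y'\<^esub> g')
          = (f \<otimes>\<^sub>m g) \<oplus>\<^bsub>Hom C (X \<otimes>\<^sub>o X') (Y \<otimes>\<^sub>o Y')\<^esub> (f \<otimes>\<^sub>m g')"
    and Tensor_smult_left:
      "\<lbrakk>X \<in> Ob C; Y \<in> Ob C; X' \<in> Ob C; Y' \<in> Ob C; f \<in> carrier (Hom C X Y);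
        g \<in> carrier (Hom C X' Y')\<rbrakk>
        \<Longrightarrow> (c \<odot>\<^bsub>Hom C X Y\<^esub> f) \<otimes>\<^sub>m g
          = c \<odot>\<^bsub>Hom C (X \<otimes>\<^sub>o X') (Y \<otimes>\<^sub>o Y')\<^esub> (f \<otimes>\<^sub>m g)"
    and Tensor_smult_right:
      "\<lbrakk>X \<in> Ob C; Y \<in> Ob C; X' \<in> Ob C; Y' \<in> Ob C; f \<in> carrier (Hom C X Y);
        g \<in> carrier (Hom C X' Y')\<rbrakk>
        \<Longrightarrow> f \<otimes>\<^sub>m (c \<odot>\<^bsub>Hom C X' Y'\<^esub> g)
          = c \<odot>\<^bsub>Hom C (X \<otimes>\<^sub>o X') (Y \<otimes>\<^sub>o Y')\<^esub> (f \<otimes>\<^sub>m g)"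
    and Adj_Tensor:
      "\<lbrakk>X \<in> Ob C; Y \<in> Ob C; X' \<in> Ob C; Y' \<in> Ob C; f \<in> carrier (Hom C X Y);
        g \<in> carrier (Hom C X' Y')\<rbrakk> \<Longrightarrow> (f \<otimes>\<^sub>m g)\<^sup>\<dagger> = f\<^sup>\<dagger> \<otimes>\<^sub>m g\<^sup>\<dagger>"

    \<comment> \<open>The tensor unit is simple.\<close>
    and Unit_simple:
      "f \<in> carrier (Hom C \<one>\<^sub>o \<one>\<^sub>o) \<Longrightarrow> \<exists>c. f = c \<odot>\<^bsub>Hom C \<one>\<^sub>o \<one>\<^sub>o\<^esub> \<one>\<^sub>m \<one>\<^sub>o"
    and Unit_nonzero: "\<one>\<^sub>m \<one>\<^sub>o \<noteq> \<zero>\<^bsub>Hom C \<one>\<^sub>o \<one>\<^sub>o\<^esub>"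

locale Q_system = strict_cstar_tensor_category C
  for C :: "('o, 'm, 'e) cstar_tensor_category_scheme" (structure) +
  fixes X :: 'o and m \<iota> :: 'm
  assumes Q_object: "X \<in> Ob C"
    and Q_mult: "m \<in> carrier (Hom C (X \<otimes>\<^sub>o X) X)"
    and Q_unit: "\<iota> \<in> carrier (Hom C \<one>\<^sub>o X)"
    and Q_assoc: "m \<cdot> (m \<otimes>\<^sub>m \<one>\<^sub>m X) = m \<cdot> (\<one>\<^sub>m X \<otimes>\<^sub>m m)"
    and Q_unital_left: "m \<cdot> (\<iota> \<otimes>\<^sub>m \<one>\<^sub>m X) = \<one>\<^sub>m X"
    and Q_unital_right: "m \<cdot> (\<one>\<^sub>m X \<otimes>\<^sub>m \<iota>) = \<one>\<^sub>m X"
    and Q_Frobenius_left: "(m \<otimes>\<^sub>m \<one>\<^sub>m X) \<cdot> (\<one>\<^sub>m X \<otimes>\<^sub>m m\<^sup>\<dagger>) = m\<^sup>\<dagger> \<cdot> m"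
    and Q_Frobenius_right: "(\<one>\<^sub>m X \<otimes>\<^sub>m m) \<cdot> (m\<^sup>\<dagger> \<otimes>\<^sub>m \<one>\<^sub>m X) = m\<^sup>\<dagger> \<cdot> m"
    and Q_special: "\<exists>d::real. d > 0 \<and> m \<cdot> m\<^sup>\<dagger> = complex_of_real d \<odot>\<^bsub>Hom C X X\<^esub> \<one>\<^sub>m X"
    and Q_normalized: "\<iota>\<^sup>\<dagger> \<cdot> \<iota> = \<one>\<^sub>m \<one>\<^sub>o"

end

(* With a = m (x) 1 and b = 1 (x) m, the two factors of the Yang-Baxter equation are a* a and
   b* b, and the Frobenius property says a b* = b a* = m* m.  Hence both sides collapse to
   p* (m m* ) p, where p = m a = m b by associativity. *)
theory Submission
  imports Defs
begin

text \<open>The hypotheses are symmetric under exchanging \<open>a\<close> and \<open>b\<close>, and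
  the right-hand side sees \<open>a\<close> only through \<open>m \<cdot> a = m \<cdot> b\<close>.
  Exchanging the two therefore leaves the value of the product unchanged. Abstract objects keep
  tensor bookkeeping out of the computation.\<close>

lemma (in cstar_category) triple_product_collapse:
  assumes ob: "U \<in> Ob C" "V \<in> Ob C" "W \<in> Ob C"
    and a: "a \<in> carrier (Hom C U V)" and b: "b \<in> carrier (Hom C U V)"
    and m: "m \<in> carrier (Hom C V W)"
    and ab: "a \<cdot> b\<^sup>\<dagger> = m\<^sup>\<dagger> \<cdot> m" and ba: "b \<cdot> a\<^sup>\<dagger> = m\<^sup>\<dagger> \<cdot> m"
    and eq: "m \<cdot> a = m \<cdot> b"
  shows "(a\<^sup>\<dagger> \<cdot> a) \<cdot> (b\<^sup>\<dagger> \<cdot> b) \<cdot> (a\<^sup>\<dagger> \<cdot> a) = (m \<cdot> a)\<^sup>\<dagger> \<cdot> (m \<cdot> m\<^sup>\<dagger> \<cdot> (m \<cdot> a))"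
proof -
  note a' = Adj_closed[OF ob(1,2) a] and b' = Adj_closed[OF ob(1,2) b]
    and m' = Adj_closed[OF ob(2,3) m]
  note aa = Comp_closed[OF ob(1,2,1) a a'] and bb = Comp_closed[OF ob(1,2,1) b b']
    and ma = Comp_closed[OF ob(1,2,3) a m]
  note p' = Adj_closed[OF ob(1,3) ma]
  have "(a\<^sup>\<dagger> \<cdot> a) \<cdot> (b\<^sup>\<dagger> \<cdot> b) = a\<^sup>\<dagger> \<cdot> (a \<cdot> b\<^sup>\<dagger> \<cdot> b)"
    using Comp_assoc[OF ob(1,1,2,1) bb a a'] Comp_assoc[OF ob(1,2,1,2) b b' a] by simp
  \<comment> \<open>The inner \<open>a \<cdot> b\<^sup>\<dagger>\<close> becomes
    \<open>m\<^sup>\<dagger> \<cdot> m\<close>; then \<open>m \<cdot> b\<close> is traded for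
    \<open>m \<cdot> a\<close>.\<close>
  also have "\<dots> = a\<^sup>\<dagger> \<cdot> (m\<^sup>\<dagger> \<cdot> (m \<cdot> a))"
    using Comp_assoc[OF ob(1,2,3,2) b m m'] ab eq by simp
  also have "\<dots> = (m \<cdot> a)\<^sup>\<dagger> \<cdot> (m \<cdot> a)"
    using Comp_assoc[OF ob(1,3,2,1) ma m' a'] Adj_Comp[OF ob a m] by simp
  finally have ab2: "(a\<^sup>\<dagger> \<cdot> a) \<cdot> (b\<^sup>\<dagger> \<cdot> b) = (m \<cdot> a)\<^sup>\<dagger> \<cdot> (m \<cdot> a)" .
  \<comment> \<open>Rewriting \<open>m \<cdot> a\<close> as \<open>m \<cdot> b\<close> exposes
    \<open>b \<cdot> a\<^sup>\<dagger>\<close>, so the other Frobenius relation absorbs the third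
    factor.\<close>
  have "m \<cdot> a \<cdot> a\<^sup>\<dagger> = m \<cdot> m\<^sup>\<dagger> \<cdot> m"
    using Comp_assoc[OF ob(2,1,2,3) a' b m] Comp_assoc[OF ob(2,3,2,3) m m' m] ba eq by simp
  then have "m \<cdot> a \<cdot> (a\<^sup>\<dagger> \<cdot> a) = m \<cdot> m\<^sup>\<dagger> \<cdot> (m \<cdot> a)"
    using Comp_assoc[OF ob(1,2,1,3) a a' ma]
      Comp_assoc[OF ob(1,2,3,3) a m Comp_closed[OF ob(3,2,3) m' m]] by simp
  then show ?thesis
    using ab2 Comp_assoc[OF ob(1,1,3,1) aa ma p'] by simp
qed

theorem proposition6p19:
  fixes C :: "('o, 'm, 'e) cstar_tensor_category_scheme" (structure)
    and X :: 'o and m \<iota> :: 'm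
  assumes "strict_cstar_tensor_category C"
    and "Q_system C X m \<iota>"
  shows "let T = m\<^sup>\<dagger> \<cdot> m in
    T \<in> carrier (Hom C (X \<otimes>\<^sub>o X) (X \<otimes>\<^sub>o X)) \<and>
    (T \<otimes>\<^sub>m \<one>\<^sub>m X) \<cdot> (\<one>\<^sub>m X \<otimes>\<^sub>m T) \<cdot> (T \<otimes>\<^sub>m \<one>\<^sub>m X) =
    (\<one>\<^sub>m X \<otimes>\<^sub>m T) \<cdot> (T \<otimes>\<^sub>m \<one>\<^sub>m X) \<cdot> (\<one>\<^sub>m X \<otimes>\<^sub>m T)"
proof -
  interpret Q_system C X m \<iota> by fact
  let ?i = "\<one>\<^sub>m X" and ?XX = "X \<otimes>\<^sub>o X"
  let ?a = "m \<otimes>\<^sub>m ?i" and ?b = "?i \<otimes>\<^sub>m m"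
  note X = Q_object and m = Q_mult
  note XX = Tensor_Ob_closed[OF X X]
  note XXX = Tensor_Ob_closed[OF X XX]
  note i = Ident_closed[OF X]
  note m' = Adj_closed[OF XX X m]
  \<comment> \<open>Take adjoints in
    \<open>?i \<cdot> ?i\<^sup>\<dagger> = ?i\<^sup>\<dagger>\<close> and use that the adjoint is
    involutive.\<close>
  have i_adj: "?i\<^sup>\<dagger> = ?i"
    using Adj_Comp[OF X X X Adj_closed[OF X X i] i] Adj_Adj[OF X X i]
      Comp_Ident_left[OF X X Adj_closed[OF X X i]] by simp
  have i_idem: "?i \<cdot> ?i = ?i" by (rule Comp_Ident_left[OF X X i])
  \<comment> \<open>Strict associativity on objects gives \<open>?a\<close> the same domain as
    \<open>?b\<close>.\<close>
  have a: "?a \<in> carrier (Hom C (X \<otimes>\<^sub>o ?XX) ?XX)"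
    using Tensor_closed[OF XX X X X m i] Tensor_Ob_assoc[OF X X X] by simp
  have b: "?b \<in> carrier (Hom C (X \<otimes>\<^sub>o ?XX) ?XX)"
    by (rule Tensor_closed[OF X X XX X i m])
  have a_adj: "?a\<^sup>\<dagger> = m\<^sup>\<dagger> \<otimes>\<^sub>m ?i"
    using Adj_Tensor[OF XX X X X m i] i_adj by simp
  have b_adj: "?b\<^sup>\<dagger> = ?i \<otimes>\<^sub>m m\<^sup>\<dagger>"
    using Adj_Tensor[OF X X XX X i m] i_adj by simp
  \<comment> \<open>Writing \<open>?i\<close> as \<open>?i \<cdot> ?i\<close> makes the interchange
    law applicable.\<close>
  have T1: "(m\<^sup>\<dagger> \<cdot> m) \<otimes>\<^sub>m ?i = ?a\<^sup>\<dagger> \<cdot> ?a"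
    using Tensor_Comp[OF XX X XX X X X m m' i i] a_adj i_idem by simp
  have T2: "?i \<otimes>\<^sub>m (m\<^sup>\<dagger> \<cdot> m) = ?b\<^sup>\<dagger> \<cdot> ?b"
    using Tensor_Comp[OF X X X XX X XX i i m m'] b_adj i_idem by simp
  have ab: "?a \<cdot> ?b\<^sup>\<dagger> = m\<^sup>\<dagger> \<cdot> m" using Q_Frobenius_left b_adj by simp
  have ba: "?b \<cdot> ?a\<^sup>\<dagger> = m\<^sup>\<dagger> \<cdot> m" using Q_Frobenius_right a_adj by simp
  \<comment> \<open>The collapse is used twice, with \<open>?a\<close> and \<open>?b\<close>
    exchanged; associativity of \<open>m\<close> identifies the two results.\<close>
  show ?thesis
    unfolding Let_def T1 T2
    using Comp_closed[OF XX X XX m m']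
      triple_product_collapse[OF XXX XX X a b m ab ba Q_assoc]
      triple_product_collapse[OF XXX XX X b a m ba ab Q_assoc[symmetric]]
      Q_assoc by simp
qed

end
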